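(* Let $P,Q\in\mathbb{H}^{n\times n}$ be nontrivial generalized reflection matrices, and let $U=[U_1,\ U_2]$ and $V=[V_1,\ V_2]$ be unitary matrices in $\mathbb{H}^{n\times n}$, with $U_1\in\mathbb{H}^{n\times r_1}$, $U_2\in\mathbb{H}^{n\times(n-r_1)}$, $V_1\in\mathbb{H}^{n\times r_2}$, $V_2\in\mathbb{H}^{n\times(n-r_2)}$, such that $$P=U\begin{bmatrix} I_{r_1}&0\\ 0&-I_{n-r_1}\end{bmatrix}U^*,\qquad Q=V\begin{bmatrix} I_{r_2}&0\\ 0&-I_{n-r_2}\end{bmatrix}V^*.$$ Let $Z\in\mathbb{H}^{n\times m}$ and $\Lambda=\mathrm{diag}(\lambda_1,\dots,\lambda_m)$, where $\lambda_1,\dots,\lambda_m$ are complex numbers with nonnegative imaginary parts. Let $0<l<m$ and suppose that $$Z=[V_2X_1,\ V_1X_2]=[U_1Y_1,\ U_2Y_2],\qquad \Lambda=\begin{bmatrix}\Phi&0\\ 0&\Psi\end{bmatrix},$$ where $X_1\in\mathbb{H}^{(n-r_2)\times l}$, $X_2\in\mathbb{H}^{r_2\times(m-l)}$, $Y_1\in\mathbb{H}^{r_1\times l}$, $Y_2\in\mathbb{H}^{(n-r_1)\times(m-l)}$, $\Phi=\mathrm{diag}(\lambda_1,\dots,\lambda_l)$, $\Psi=\mathrm{diag}(\lambda_{l+1},\dots,\lambda_m)$. Then the set $$\varphi_2(Z,\Lambda)=\{A\in\mathbb{H}_a^{n\times n}(P,Q)\ :\ AZ=Z\Lambda\}$$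 is nonempty if and only if $$Y_1\Phi X_1^{+}X_1=Y_1\Phi,\qquad Y_2\Psi X_2^{+}X_2=Y_2\Psi.$$ In that case, the general expression of $A\in\varphi_2(Z,\Lambda)$ is $$A=[U_1,\ U_2]\begin{bmatrix}0&Y_1\Phi X_1^{+}+W_1R_{X_1}\\ Y_2\Psi X_2^{+}+W_2R_{X_2}&0\end{bmatrix}\begin{bmatrix}V_1^*\\ V_2^*\end{bmatrix},$$ where $W_1\in\mathbb{H}^{r_1\times(n-r_2)}$ and $W_2\in\mathbb{H}^{(n-r_1)\times r_2}$ are arbitrary.
   Context: $\mathbb{H}$ is the real quaternion algebra, $\mathbb{H}^{m\times n}$ the set of $m\times n$ matrices over $\mathbb{H}$, and $^*$ denotes conjugate transpose. A matrix $P\in\mathbb{H}^{n\times n}$ is a nontrivial generalized reflection matrix if $P^*=P\neq I$ and $P^2=I$. $\mathbb{H}_a^{n\times n}(P,Q)=\{A\in\mathbb{H}^{n\times n}: A=-PAQ\}$ is the set of generalized antireflexive matrices with respect to $(P,Q)$. For a matrix $X$, $X^{+}$ denotes an arbitrary but fixed reflexive inverse of $X$, i.e. a matrix with $XX^{+}X=X$ and $X^{+}XX^{+}=X^{+}$; and $R_X=I-XX^{+}$. "General expression" means that $\varphi_2(Z,\Lambda)$ is exactly the set of matrices of the displayed form as $W_1,W_2$ vary. *)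

theory Defs
  imports Complex_Main "Jordan_Normal_Form.Matrix"
begin

section \<open>The real quaternion algebra\<close>

text \<open>\<open>Quat a b c d\<close> stands for \<open>a + b i + c j + d k\<close>.\<close>

codatatype quat = Quat (qRe: real) (qI: real) (qJ: real) (qK: real)

lemma quat_eq_iff: "x = y \<longleftrightarrow> qRe x = qRe y \<and> qI x = qI y \<and> qJ x = qJ y \<and> qK x = qK y"
  by (auto intro: quat.expand)

instantiation quat :: ab_group_add
begin

primcorec zero_quat where
  "qRe 0 = 0" | "qI 0 = 0" | "qJ 0 = 0" | "qK 0 = 0"

primcorec plus_quat where
  "qRe (x + y) = qRe x + qRe y"
| "qI (x + y) = qI x + qI y"
| "qJ (x + y) = qJ x + qJ y"
| "qK (x + y) = qK x + qK y"

primcorec uminus_quat where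
  "qRe (- x) = - qRe x"
| "qI (- x) = - qI x"
| "qJ (- x) = - qJ x"
| "qK (- x) = - qK x"

primcorec minus_quat where
  "qRe (x - y) = qRe x - qRe y"
| "qI (x - y) = qI x - qI y"
| "qJ (x - y) = qJ x - qJ y"
| "qK (x - y) = qK x - qK y"

instance
  by standard (simp_all add: quat_eq_iff)

end

instantiation quat :: real_algebra_1
begin

primcorec one_quat where
  "qRe 1 = 1" | "qI 1 = 0" | "qJ 1 = 0" | "qK 1 = 0"

primcorec times_quat where
  "qRe (x * y) = qRe x * qRe y - qI x * qI y - qJ x * qJ y - qK x * qK y"
| "qI (x * y) = qRe x * qI y + qI x * qRe y + qJ x * qK y - qK x * qJ y"
| "qJ (x * y) = qRe x * qJ y - qI x * qK y + qJ x * qRe y + qK x * qI y"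
| "qK (x * y) = qRe x * qK y + qI x * qJ y - qJ x * qI y + qK x * qRe y"

primcorec scaleR_quat where
  "qRe (scaleR r x) = r * qRe x"
| "qI (scaleR r x) = r * qI x"
| "qJ (scaleR r x) = r * qJ x"
| "qK (scaleR r x) = r * qK x"

instance
  by standard (simp_all add: quat_eq_iff algebra_simps)

end

lemma quat_mult_table:
  fixes i j k :: quat
  defines "i \<equiv> Quat 0 1 0 0" and "j \<equiv> Quat 0 0 1 0" and "k \<equiv> Quat 0 0 0 1"
  shows "i * i = -1" "j * j = -1" "k * k = -1" "i * j = k" "j * k = i" "k * i = j"
    "j * i = - k" "k * j = - i" "i * k = - j"
  by (simp_all add: i_def j_def k_def quat_eq_iff)

text \<open>Quaternion conjugation is an antiautomorphism, so only the basic class \<open>conjugate\<close>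
  applies, not \<open>conjugatable_ring\<close>.\<close>

instantiation quat :: conjugate
begin

primcorec conjugate_quat where
  "qRe (conjugate x) = qRe x"
| "qI (conjugate x) = - qI x"
| "qJ (conjugate x) = - qJ x"
| "qK (conjugate x) = - qK x"

instance
  by standard (auto simp: quat_eq_iff)

end

lemma quat_conjugate_mult: "conjugate (x * y) = conjugate y * conjugate (x :: quat)"
  by (simp add: quat_eq_iff algebra_simps)

definition quat_of_complex :: "complex \<Rightarrow> quat" where
  "quat_of_complex z = Quat (Re z) (Im z) 0 0"


section \<open>Quaternion matrices\<close>

definition conj_transpose :: "quat mat \<Rightarrow> quat mat"  (\<open>_\<^sup>H\<close> [1000] 999) where
  "A\<^sup>H = transpose_mat (map_mat conjugate A)"

text \<open>The block row \<open>[A, B]\<close>, for \<open>A\<close> and \<open>B\<close> with the same number of rows.\<close>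

definition append_cols :: "'a :: zero mat \<Rightarrow> 'a mat \<Rightarrow> 'a mat"  (infixr \<open>@\<^sub>c\<close> 65) where
  "A @\<^sub>c B = four_block_mat A B (0\<^sub>m 0 (dim_col A)) (0\<^sub>m 0 (dim_col B))"

definition unitary_qmat :: "nat \<Rightarrow> quat mat \<Rightarrow> bool" where
  "unitary_qmat n U \<longleftrightarrow> U \<in> carrier_mat n n \<and> U\<^sup>H * U = 1\<^sub>m n \<and> U * U\<^sup>H = 1\<^sub>m n"

definition nontrivial_gen_reflection :: "nat \<Rightarrow> quat mat \<Rightarrow> bool" where
  "nontrivial_gen_reflection n P \<longleftrightarrow>
     P \<in> carrier_mat n n \<and> P\<^sup>H = P \<and> P \<noteq> 1\<^sub>m n \<and> P * P = 1\<^sub>m n"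

definition antireflexive_mats :: "nat \<Rightarrow> quat mat \<Rightarrow> quat mat \<Rightarrow> quat mat set" where
  "antireflexive_mats n P Q = {A \<in> carrier_mat n n. A = - (P * A * Q)}"

definition quat_diag :: "nat \<Rightarrow> (nat \<Rightarrow> complex) \<Rightarrow> quat mat" where
  "quat_diag k d = mat_diag k (\<lambda>i. quat_of_complex (d i))"

definition reflexive_inverse :: "quat mat \<Rightarrow> quat mat \<Rightarrow> bool" where
  "reflexive_inverse X Y \<longleftrightarrow>
     Y \<in> carrier_mat (dim_col X) (dim_row X) \<and> X * Y * X = X \<and> Y * X * Y = Y"

text \<open>\<open>R_proj X Y\<close> is \<open>R\<^sub>X = I - X X\<^sup>+\<close>, where the second argument is the chosen reflexive
  inverse \<open>X\<^sup>+\<close>.\<close>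

definition R_proj :: "quat mat \<Rightarrow> quat mat \<Rightarrow> quat mat" where
  "R_proj X Y = 1\<^sub>m (dim_row X) - X * Y"

definition phi2 :: "nat \<Rightarrow> quat mat \<Rightarrow> quat mat \<Rightarrow> quat mat \<Rightarrow> quat mat \<Rightarrow> quat mat set" where
  "phi2 n P Q Z \<Lambda> = {A \<in> antireflexive_mats n P Q. A * Z = Z * \<Lambda>}"

end

theory Submission
  imports Defs
begin

text \<open>Write \<open>U = [U\<^sub>1, U\<^sub>2]\<close>, \<open>V = [V\<^sub>1, V\<^sub>2]\<close> and \<open>A = U B V\<^sup>*\<close>. In these coordinates
  \<open>A = - P A Q\<close> says that the diagonal blocks of \<open>B\<close> vanish, and \<open>A Z = Z \<Lambda>\<close> then decouples
  into \<open>B\<^sub>1\<^sub>2 X\<^sub>1 = Y\<^sub>1 \<Phi>\<close> and \<open>B\<^sub>2\<^sub>1 X\<^sub>2 = Y\<^sub>2 \<Psi>\<close>. Each of these linear equations is solved by means of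
  the inner inverse of its coefficient matrix.\<close>

section \<open>Solving linear equations with an inner inverse\<close>

text \<open>Reassociating brings out the factor \<open>X * Y * X\<close>. With \<open>B * X\<close>
  replaced by a right-hand side \<open>C\<close>, this is the consistency condition
  \<open>C * Y * X = C\<close> that any solvable equation \<open>B * X = C\<close> must
  satisfy.\<close>

lemma inner_inverse_consistent:
  fixes X :: "'a :: ring_1 mat"
  assumes X: "X \<in> carrier_mat p q" and Y: "Y \<in> carrier_mat q p" and B: "B \<in> carrier_mat r p"
    and XYX: "X * Y * X = X"
  shows "B * X * Y * X = B * X"
proof -
  have "B * X * Y * X = B * (X * Y) * X"
    by (simp only: assoc_mult_mat[OF B X Y])
  also have "\<dots> = B * (X * Y * X)"
    by (rule assoc_mult_mat[OF B mult_carrier_mat[OF X Y] X])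
  finally show ?thesis
    by (simp only: XYX)
qed

text \<open>Consistency makes \<open>C * Y\<close> a particular solution, and the terms
  \<open>W * (1\<^sub>m p - X * Y)\<close> solve the homogeneous equation because
  \<open>1\<^sub>m p - X * Y\<close> annihilates \<open>X\<close> from the left. All solutions arise
  this way, since each one can serve as its own parameter.\<close>

lemma inner_inverse_solutions:
  fixes X :: "'a :: ring_1 mat"
  assumes X: "X \<in> carrier_mat p q" and Y: "Y \<in> carrier_mat q p" and C: "C \<in> carrier_mat r q"
    and XYX: "X * Y * X = X" and CYX: "C * Y * X = C"
  shows "{B \<in> carrier_mat r p. B * X = C} =
    {C * Y + W * (1\<^sub>m p - X * Y) | W. W \<in> carrier_mat r p}" (is "?L = ?R")
proof (intro equalityI subsetI)
  fix B assume "B \<in> ?L"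
  then have B: "B \<in> carrier_mat r p" and BX: "B * X = C"
    by auto
  have CYc: "C * Y \<in> carrier_mat r p"
    using C Y by simp
  \<comment> \<open>The parameter chosen for a given solution \<open>B\<close> is
    \<open>W = B\<close>; the product below is then exactly the difference between \<open>B\<close>
    and the particular solution.\<close>
  have "B * (1\<^sub>m p - X * Y) = B * 1\<^sub>m p - B * (X * Y)"
    using X Y B by (intro mult_minus_distrib_mat) auto
  also have "\<dots> = B - C * Y"
    using X Y B by (simp flip: BX)
  finally have "B = C * Y + B * (1\<^sub>m p - X * Y)"
    using B CYc by (auto intro!: eq_matI)
  then show "B \<in> ?R"
    using B by blast
next
  fix B assume "B \<in> ?R"
  then obtain W where W: "W \<in> carrier_mat r p" and B: "B = C * Y + W * (1\<^sub>m p - X * Y)"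
    by auto
  have N: "1\<^sub>m p - X * Y \<in> carrier_mat p p" and CYc: "C * Y \<in> carrier_mat r p"
    using X Y C by auto
  have "(1\<^sub>m p - X * Y) * X = 1\<^sub>m p * X - X * Y * X"
    using X Y by (intro minus_mult_distrib_mat) auto
  then have NX: "(1\<^sub>m p - X * Y) * X = 0\<^sub>m p q"
    using X by (simp add: XYX)
  have "B * X = C * Y * X + W * (1\<^sub>m p - X * Y) * X"
    unfolding B by (rule add_mult_distrib_mat[OF CYc mult_carrier_mat[OF W N] X])
  also have "W * (1\<^sub>m p - X * Y) * X = W * ((1\<^sub>m p - X * Y) * X)"
    by (rule assoc_mult_mat[OF W N X])
  also have "C * Y * X + \<dots> = C"
    unfolding NX CYX using C W by simp
  finally show "B \<in> ?L"
    using B W CYc N by auto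
qed

section \<open>Block matrices and sign changes\<close>

text \<open>Corresponding blocks must have the same size: otherwise one matrix cut at two different
  places would refute the equivalence. Offsets by \<open>nr1\<close> and \<open>nc1\<close> then
  reach the entries of each block.\<close>

lemma four_block_mat_eq_iff:
  assumes "A \<in> carrier_mat nr1 nc1" "B \<in> carrier_mat nr1 nc2"
    "C \<in> carrier_mat nr2 nc1" "D \<in> carrier_mat nr2 nc2"
    "A' \<in> carrier_mat nr1 nc1" "B' \<in> carrier_mat nr1 nc2"
    "C' \<in> carrier_mat nr2 nc1" "D' \<in> carrier_mat nr2 nc2"
  shows "four_block_mat A B C D = four_block_mat A' B' C' D' \<longleftrightarrow>
    A = A' \<and> B = B' \<and> C = C' \<and> D = D'" (is "?M = ?M' \<longleftrightarrow> _")
proof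
  assume eq: "?M = ?M'"
  have e: "?M $$ (i, j) = ?M' $$ (i, j)" for i j
    by (simp add: eq)
  have "A $$ (i, j) = A' $$ (i, j)" if "i < nr1" "j < nc1" for i j
    using e[of i j] that assms by simp
  moreover have "B $$ (i, j) = B' $$ (i, j)" if "i < nr1" "j < nc2" for i j
    using e[of i "nc1 + j"] that assms by simp
  moreover have "C $$ (i, j) = C' $$ (i, j)" if "i < nr2" "j < nc1" for i j
    using e[of "nr1 + i" j] that assms by simp
  moreover have "D $$ (i, j) = D' $$ (i, j)" if "i < nr2" "j < nc2" for i j
    using e[of "nr1 + i" "nc1 + j"] that assms by simp
  ultimately show "A = A' \<and> B = B' \<and> C = C' \<and> D = D'"
    using assms by (auto intro!: eq_matI)
qed simp

text \<open>A block row is encoded as a four-block matrix whose lower blocks have no rows, so the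
  general block product applies and its lower blocks are again empty.\<close>

lemma append_cols_mult_four_block_mat:
  fixes U1 :: "'a :: semiring_0 mat"
  assumes U: "U1 \<in> carrier_mat n a" "U2 \<in> carrier_mat n b"
    and M: "A \<in> carrier_mat a c" "B \<in> carrier_mat a d" "C \<in> carrier_mat b c" "D \<in> carrier_mat b d"
  shows "(U1 @\<^sub>c U2) * four_block_mat A B C D = (U1 * A + U2 * C) @\<^sub>c (U1 * B + U2 * D)"
proof -
  have "(U1 @\<^sub>c U2) * four_block_mat A B C D =
      four_block_mat (U1 * A + U2 * C) (U1 * B + U2 * D)
        (0\<^sub>m 0 a * A + 0\<^sub>m 0 b * C) (0\<^sub>m 0 a * B + 0\<^sub>m 0 b * D)"
    using U unfolding append_cols_def
    by (subst mult_four_block_mat[OF _ _ _ _ M, of _ n _ _ 0]) auto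
  then show ?thesis
    using U M unfolding append_cols_def by simp
qed

lemma conj_transpose_carrier:
  "A \<in> carrier_mat nr nc \<Longrightarrow> A\<^sup>H \<in> carrier_mat nc nr"
  unfolding conj_transpose_def by auto

text \<open>Links \<open>V\<^sup>H\<close>, which suits the unitary cancellations, to the stacked
  form in which the general solution is displayed.\<close>

lemma conj_transpose_append_cols:
  assumes "A \<in> carrier_mat n a" "B \<in> carrier_mat n b"
  shows "(A @\<^sub>c B)\<^sup>H = A\<^sup>H @\<^sub>r B\<^sup>H"
  using assms unfolding conj_transpose_def append_cols_def append_rows_def
  by (intro eq_matI) auto

text \<open>The left factor negates the lower block row and the right factor the right block column;
  \<open>D\<close> meets both signs and \<open>A\<close> neither.\<close>

lemma reflection_mult_four_block_mat:
  fixes A :: "'a :: ring_1 mat"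
  assumes M: "A \<in> carrier_mat a c" "B \<in> carrier_mat a d" "C \<in> carrier_mat b c" "D \<in> carrier_mat b d"
  shows "four_block_mat (1\<^sub>m a) (0\<^sub>m a b) (0\<^sub>m b a) (- 1\<^sub>m b) * four_block_mat A B C D
      * four_block_mat (1\<^sub>m c) (0\<^sub>m c d) (0\<^sub>m d c) (- 1\<^sub>m d)
    = four_block_mat A (- B) (- C) D"
proof -
  have "four_block_mat (1\<^sub>m a) (0\<^sub>m a b) (0\<^sub>m b a) (- 1\<^sub>m b) * four_block_mat A B C D =
      four_block_mat A B (- C) (- D)"
    using M by (subst mult_four_block_mat[OF _ _ _ _ M, of _ a _ _ b]) auto
  also have "\<dots> * four_block_mat (1\<^sub>m c) (0\<^sub>m c d) (0\<^sub>m d c) (- 1\<^sub>m d) =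
      four_block_mat A (- B) (- C) D"
    using M by (subst mult_four_block_mat[of _ a c _ d _ b _ _ c _ d]) auto
  finally show ?thesis .
qed

text \<open>Entrywise the equation reads \<open>x = - x\<close>, which forces each of the four real
  components to vanish.\<close>

lemma quat_mat_eq_uminus_iff:
  fixes A :: "quat mat"
  assumes "A \<in> carrier_mat nr nc"
  shows "A = - A \<longleftrightarrow> A = 0\<^sub>m nr nc"
proof
  assume eq: "A = - A"
  show "A = 0\<^sub>m nr nc"
  proof (rule eq_matI)
    fix i j assume ij: "i < dim_row (0\<^sub>m nr nc :: quat mat)" "j < dim_col (0\<^sub>m nr nc :: quat mat)"
    have "A $$ (i, j) = (- A) $$ (i, j)"
      using eq by simp
    then have "A $$ (i, j) = - (A $$ (i, j))"
      using ij assms by simp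
    then show "A $$ (i, j) = 0\<^sub>m nr nc $$ (i, j)"
      using ij by (simp add: quat_eq_iff)
  qed (use assms in auto)
next
  assume "A = 0\<^sub>m nr nc"
  then show "A = - A"
    by (auto intro: eq_matI)
qed

section \<open>Unitary coordinates\<close>

text \<open>Injectivity of the coordinate map: multiplying by \<open>U\<^sup>H\<close> on the left
  and \<open>V\<close> on the right recovers the middle factor.\<close>

lemma unitary_qmat_cancel:
  assumes U: "unitary_qmat n U" and V: "unitary_qmat n V"
    and M: "M \<in> carrier_mat n n" and N: "N \<in> carrier_mat n n"
  shows "U * M * V\<^sup>H = U * N * V\<^sup>H \<longleftrightarrow> M = N"
proof
  have Uc: "U \<in> carrier_mat n n" "U\<^sup>H \<in> carrier_mat n n" "U\<^sup>H * U = 1\<^sub>m n"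
    using U by (auto simp: unitary_qmat_def conj_transpose_carrier)
  have Vc: "V \<in> carrier_mat n n" "V\<^sup>H \<in> carrier_mat n n" "V\<^sup>H * V = 1\<^sub>m n"
    using V by (auto simp: unitary_qmat_def conj_transpose_carrier)
  have undo: "U\<^sup>H * (U * K * V\<^sup>H) * V = K" if K: "K \<in> carrier_mat n n" for K
  proof -
    have "U\<^sup>H * (U * K * V\<^sup>H) * V = (U\<^sup>H * U) * K * (V\<^sup>H * V)"
      using K Uc(1,2) Vc(1,2) by (simp add: mult_carrier_mat[of _ n n _ n] assoc_mult_mat[of _ n n _ n _ n])
    then show ?thesis
      using K Uc(3) Vc(3) by simp
  qed
  assume "U * M * V\<^sup>H = U * N * V\<^sup>H"
  then show "M = N"
    using undo[OF M] undo[OF N] by metis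
qed simp

lemma unitary_qmat_cancel_left:
  assumes U: "unitary_qmat n U" and M: "M \<in> carrier_mat n m" and N: "N \<in> carrier_mat n m"
  shows "U * M = U * N \<longleftrightarrow> M = N"
proof
  have Uc: "U \<in> carrier_mat n n" "U\<^sup>H \<in> carrier_mat n n" "U\<^sup>H * U = 1\<^sub>m n"
    using U by (auto simp: unitary_qmat_def conj_transpose_carrier)
  assume "U * M = U * N"
  then have "U\<^sup>H * U * M = U\<^sup>H * U * N"
    using Uc(1,2) M N by simp
  then show "M = N"
    using Uc(3) M N by simp
qed simp

text \<open>Surjectivity of the coordinate map, with witness \<open>U\<^sup>H * A * V\<close>; here
  the identities \<open>U * U\<^sup>H = 1\<^sub>m n\<close> and
  \<open>V * V\<^sup>H = 1\<^sub>m n\<close> are the ones that count.\<close>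

lemma unitary_qmat_coordinates:
  assumes U: "unitary_qmat n U" and V: "unitary_qmat n V" and A: "A \<in> carrier_mat n n"
  obtains B where "B \<in> carrier_mat n n" "A = U * B * V\<^sup>H"
proof
  have Uc: "U \<in> carrier_mat n n" "U\<^sup>H \<in> carrier_mat n n" "U * U\<^sup>H = 1\<^sub>m n"
    using U by (auto simp: unitary_qmat_def conj_transpose_carrier)
  have Vc: "V \<in> carrier_mat n n" "V\<^sup>H \<in> carrier_mat n n" "V * V\<^sup>H = 1\<^sub>m n"
    using V by (auto simp: unitary_qmat_def conj_transpose_carrier)
  show "U\<^sup>H * A * V \<in> carrier_mat n n"
    using A Uc Vc by (metis mult_carrier_mat)
  have "U * (U\<^sup>H * A * V) * V\<^sup>H = (U * U\<^sup>H) * A * (V * V\<^sup>H)"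
    using A Uc(1,2) Vc(1,2) by (simp add: mult_carrier_mat[of _ n n _ n] assoc_mult_mat[of _ n n _ n _ n])
  then show "A = U * (U\<^sup>H * A * V) * V\<^sup>H"
    using A Uc(3) Vc(3) by simp
qed

text \<open>In unitary coordinates \<open>P\<close> and \<open>Q\<close> become diagonal sign
  matrices, so antireflexivity only compares signs block by block, and a block equal to its own
  negative is zero.\<close>

lemma antireflexive_four_block_iff:
  assumes U: "unitary_qmat n U" and V: "unitary_qmat n V"
    and P: "P = U * four_block_mat (1\<^sub>m a) (0\<^sub>m a b) (0\<^sub>m b a) (- 1\<^sub>m b) * U\<^sup>H"
    and Q: "Q = V * four_block_mat (1\<^sub>m c) (0\<^sub>m c d) (0\<^sub>m d c) (- 1\<^sub>m d) * V\<^sup>H"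
    and n: "n = a + b" "n = c + d"
    and M: "A \<in> carrier_mat a c" "B \<in> carrier_mat a d" "C \<in> carrier_mat b c" "D \<in> carrier_mat b d"
  shows "U * four_block_mat A B C D * V\<^sup>H \<in> antireflexive_mats n P Q \<longleftrightarrow>
    A = 0\<^sub>m a c \<and> D = 0\<^sub>m b d"
proof -
  let ?M = "four_block_mat A B C D"
  let ?J = "four_block_mat (1\<^sub>m a) (0\<^sub>m a b) (0\<^sub>m b a) (- 1\<^sub>m b) :: quat mat"
  let ?K = "four_block_mat (1\<^sub>m c) (0\<^sub>m c d) (0\<^sub>m d c) (- 1\<^sub>m d) :: quat mat"
  have Uc: "U \<in> carrier_mat n n" "U\<^sup>H \<in> carrier_mat n n" "U\<^sup>H * U = 1\<^sub>m n"
    using U by (auto simp: unitary_qmat_def conj_transpose_carrier)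
  have Vc: "V \<in> carrier_mat n n" "V\<^sup>H \<in> carrier_mat n n" "V\<^sup>H * V = 1\<^sub>m n"
    using V by (auto simp: unitary_qmat_def conj_transpose_carrier)
  have Mc: "?M \<in> carrier_mat n n"
    using M n by (metis four_block_carrier_mat)
  have Jc: "?J \<in> carrier_mat n n"
    unfolding n(1) by (intro four_block_carrier_mat) auto
  have Kc: "?K \<in> carrier_mat n n"
    unfolding n(2) by (intro four_block_carrier_mat) auto
  have "P * (U * ?M * V\<^sup>H) * Q = U * (?J * ((U\<^sup>H * U) * ?M * (V\<^sup>H * V)) * ?K) * V\<^sup>H"
    unfolding P Q using Uc(1,2) Vc(1,2) Mc Jc Kc
    by (simp add: mult_carrier_mat[of _ n n _ n] assoc_mult_mat[of _ n n _ n _ n])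
  also have "\<dots> = U * (?J * ?M * ?K) * V\<^sup>H"
    unfolding Uc(3) Vc(3) left_mult_one_mat[OF Mc] right_mult_one_mat[OF Mc] ..
  also have "?J * ?M * ?K = four_block_mat A (- B) (- C) D"
    by (rule reflection_mult_four_block_mat[OF M])
  finally have "- (P * (U * ?M * V\<^sup>H) * Q) = - (U * four_block_mat A (- B) (- C) D * V\<^sup>H)"
    by simp
  also have "\<dots> = U * (- four_block_mat A (- B) (- C) D) * V\<^sup>H"
    using Uc Vc M n by simp
  \<comment> \<open>The outer minus restores the off-diagonal blocks and moves the sign to the
    diagonal ones, so only \<open>A\<close> and \<open>D\<close> get constrained.\<close>
  also have "- four_block_mat A (- B) (- C) D = four_block_mat (- A) B C (- D)"
    using M by (intro eq_matI) auto
  finally have eq: "- (P * (U * ?M * V\<^sup>H) * Q) = U * four_block_mat (- A) B C (- D) * V\<^sup>H" .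
  have Mc': "four_block_mat (- A) B C (- D) \<in> carrier_mat n n"
    unfolding n(1) using M n by auto
  have "U * ?M * V\<^sup>H \<in> antireflexive_mats n P Q \<longleftrightarrow> ?M = four_block_mat (- A) B C (- D)"
    unfolding antireflexive_mats_def
    using unitary_qmat_cancel[OF U V Mc Mc'] mult_carrier_mat[OF mult_carrier_mat[OF Uc(1) Mc] Vc(2)]
    by (simp add: eq)
  also have "\<dots> \<longleftrightarrow> A = - A \<and> D = - D"
    using M by (subst four_block_mat_eq_iff[of _ a c _ d _ b]) auto
  finally show ?thesis
    using M by (simp add: quat_mat_eq_uminus_iff)
qed

section \<open>Antireflexive solutions of \<open>A * Z = Z * \<Lambda>\<close>\<close>

text \<open>The values \<open>lam\<close> are numbered from 1 while matrix indices start at 0, hence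
  the shifts by one in the diagonal matrices.\<close>

theorem theorem2p8:
  fixes n m l r1 r2 :: nat
    and P Q U1 U2 V1 V2 Z \<Lambda> \<Phi> \<Psi> X1 X2 Y1 Y2 X1p X2p :: "quat mat"
    and lam :: "nat \<Rightarrow> complex"
  assumes P: "nontrivial_gen_reflection n P"
    and Q: "nontrivial_gen_reflection n Q"
    and r1: "r1 \<le> n" and r2: "r2 \<le> n"
    and U1: "U1 \<in> carrier_mat n r1" and U2: "U2 \<in> carrier_mat n (n - r1)"
    and V1: "V1 \<in> carrier_mat n r2" and V2: "V2 \<in> carrier_mat n (n - r2)"
    and U: "unitary_qmat n (U1 @\<^sub>c U2)"
    and V: "unitary_qmat n (V1 @\<^sub>c V2)"
    and P_decomp: "P = (U1 @\<^sub>c U2)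
          * four_block_mat (1\<^sub>m r1) (0\<^sub>m r1 (n - r1)) (0\<^sub>m (n - r1) r1) (- 1\<^sub>m (n - r1))
          * (U1 @\<^sub>c U2)\<^sup>H"
    and Q_decomp: "Q = (V1 @\<^sub>c V2)
          * four_block_mat (1\<^sub>m r2) (0\<^sub>m r2 (n - r2)) (0\<^sub>m (n - r2) r2) (- 1\<^sub>m (n - r2))
          * (V1 @\<^sub>c V2)\<^sup>H"
    and Z: "Z \<in> carrier_mat n m"
    and lam: "\<forall>i \<in> {1..m}. Im (lam i) \<ge> 0"
    and \<Lambda>: "\<Lambda> = quat_diag m (\<lambda>i. lam (i + 1))"
    and l: "0 < l" "l < m"
    and X1: "X1 \<in> carrier_mat (n - r2) l" and X2: "X2 \<in> carrier_mat r2 (m - l)"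
    and Y1: "Y1 \<in> carrier_mat r1 l" and Y2: "Y2 \<in> carrier_mat (n - r1) (m - l)"
    and Z_X: "Z = (V2 * X1) @\<^sub>c (V1 * X2)"
    and Z_Y: "Z = (U1 * Y1) @\<^sub>c (U2 * Y2)"
    and \<Phi>: "\<Phi> = quat_diag l (\<lambda>i. lam (i + 1))"
    and \<Psi>: "\<Psi> = quat_diag (m - l) (\<lambda>i. lam (l + i + 1))"
    and \<Lambda>_blocks: "\<Lambda> = four_block_mat \<Phi> (0\<^sub>m l (m - l)) (0\<^sub>m (m - l) l) \<Psi>"
    and X1p: "reflexive_inverse X1 X1p"
    and X2p: "reflexive_inverse X2 X2p"
  shows "(phi2 n P Q Z \<Lambda> \<noteq> {} \<longleftrightarrow>
            Y1 * \<Phi> * X1p * X1 = Y1 * \<Phi> \<and> Y2 * \<Psi> * X2p * X2 = Y2 * \<Psi>)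
       \<and> (phi2 n P Q Z \<Lambda> \<noteq> {} \<longrightarrow>
            phi2 n P Q Z \<Lambda> =
              {(U1 @\<^sub>c U2)
                 * four_block_mat
                     (0\<^sub>m r1 r2)                                (Y1 * \<Phi> * X1p + W1 * R_proj X1 X1p)
                     (Y2 * \<Psi> * X2p + W2 * R_proj X2 X2p)       (0\<^sub>m (n - r1) (n - r2))
                 * (V1\<^sup>H @\<^sub>r V2\<^sup>H)
               | W1 W2. W1 \<in> carrier_mat r1 (n - r2) \<and> W2 \<in> carrier_mat (n - r1) r2})"
proof -
  let ?U = "U1 @\<^sub>c U2" and ?V = "V1 @\<^sub>c V2"
  let ?B = "\<lambda>B C. four_block_mat (0\<^sub>m r1 r2) B C (0\<^sub>m (n - r1) (n - r2))"
  let ?S1 = "{B \<in> carrier_mat r1 (n - r2). B * X1 = Y1 * \<Phi>}"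
  let ?S2 = "{C \<in> carrier_mat (n - r1) r2. C * X2 = Y2 * \<Psi>}"
  have Uc: "?U \<in> carrier_mat n n" and Vc: "?V \<in> carrier_mat n n"
    and VV: "?V\<^sup>H * ?V = 1\<^sub>m n" and VHc: "?V\<^sup>H \<in> carrier_mat n n"
    using U V by (auto simp: unitary_qmat_def conj_transpose_carrier)
  have Phi: "\<Phi> \<in> carrier_mat l l" and Psi: "\<Psi> \<in> carrier_mat (m - l) (m - l)"
    unfolding \<Phi> \<Psi> quat_diag_def by auto
  have X1p': "X1p \<in> carrier_mat l (n - r2)" "X1 * X1p * X1 = X1"
    using X1p X1 by (auto simp: reflexive_inverse_def)
  have X2p': "X2p \<in> carrier_mat (m - l) r2" "X2 * X2p * X2 = X2"
    using X2p X2 by (auto simp: reflexive_inverse_def)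
  have Y1c: "Y1 * \<Phi> \<in> carrier_mat r1 l" and Y2c: "Y2 * \<Psi> \<in> carrier_mat (n - r1) (m - l)"
    using Y1 Y2 Phi Psi by auto
  \<comment> \<open>\<open>V2\<close> carries the first columns of \<open>Z\<close>, so
    \<open>X1\<close> lands in the lower left block and \<open>X2\<close> in the upper right. An
    off-diagonal coefficient matrix therefore sends this factor to a block diagonal one.\<close>
  have VX: "?V * four_block_mat (0\<^sub>m r2 l) X2 X1 (0\<^sub>m (n - r2) (m - l)) = Z"
    unfolding Z_X using V1 V2 X1 X2
    by (subst append_cols_mult_four_block_mat[of _ n r2 _ "n - r2" _ l _ "m - l"]) auto
  have UY: "?U * four_block_mat Y1 (0\<^sub>m r1 (m - l)) (0\<^sub>m (n - r1) l) Y2 = Z"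
    unfolding Z_Y using U1 U2 Y1 Y2
    by (subst append_cols_mult_four_block_mat[of _ n r1 _ "n - r1" _ l _ "m - l"]) auto
  have Ybc: "four_block_mat Y1 (0\<^sub>m r1 (m - l)) (0\<^sub>m (n - r1) l) Y2 \<in> carrier_mat n m"
    using four_block_carrier_mat[OF Y1 Y2] r1 l by simp
  have Xbc: "four_block_mat (0\<^sub>m r2 l) X2 X1 (0\<^sub>m (n - r2) (m - l)) \<in> carrier_mat n m"
    using four_block_carrier_mat[of "0\<^sub>m r2 l" r2 l "0\<^sub>m (n - r2) (m - l)" "n - r2" "m - l"] r2 l by simp
  have \<Lambda>c: "\<Lambda> \<in> carrier_mat m m"
    unfolding \<Lambda> quat_diag_def by simp
  \<comment> \<open>On this side \<open>Z\<close> is written through \<open>U\<close>, so that a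
    common left factor \<open>?U\<close> can be cancelled later.\<close>
  have "Z * \<Lambda> = ?U * (four_block_mat Y1 (0\<^sub>m r1 (m - l)) (0\<^sub>m (n - r1) l) Y2 * \<Lambda>)"
    using assoc_mult_mat[OF Uc Ybc \<Lambda>c] by (simp add: UY)
  also have "four_block_mat Y1 (0\<^sub>m r1 (m - l)) (0\<^sub>m (n - r1) l) Y2 * \<Lambda> =
      four_block_mat (Y1 * \<Phi>) (0\<^sub>m r1 (m - l)) (0\<^sub>m (n - r1) l) (Y2 * \<Psi>)"
    unfolding \<Lambda>_blocks using Y1 Y2 Phi Psi
    by (subst mult_four_block_mat[of _ r1 l _ "m - l" _ "n - r1" _ _ l _ "m - l"]) auto
  finally have Z\<Lambda>: "Z * \<Lambda> =
      ?U * four_block_mat (Y1 * \<Phi>) (0\<^sub>m r1 (m - l)) (0\<^sub>m (n - r1) l) (Y2 * \<Psi>)" .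

  \<comment> \<open>On the left \<open>Z\<close> is written through \<open>V\<close>, which absorbs
    \<open>?V\<^sup>H\<close>. After cancelling \<open>?U\<close>, two block diagonal matrices
    remain, and their diagonal blocks give the two independent equations.\<close>
  have eigen: "?U * ?B B C * ?V\<^sup>H * Z = Z * \<Lambda> \<longleftrightarrow> B * X1 = Y1 * \<Phi> \<and> C * X2 = Y2 * \<Psi>"
    if B: "B \<in> carrier_mat r1 (n - r2)" and C: "C \<in> carrier_mat (n - r1) r2" for B C
  proof -
    let ?X = "four_block_mat (0\<^sub>m r2 l) X2 X1 (0\<^sub>m (n - r2) (m - l))"
    have Bc: "?B B C \<in> carrier_mat n n"
      using four_block_carrier_mat[of "0\<^sub>m r1 r2" r1 r2 "0\<^sub>m (n - r1) (n - r2)" "n - r1" "n - r2"] r1 r2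
      by simp
    have BXc: "?B B C * ?X \<in> carrier_mat n m"
      using Bc Xbc by (rule mult_carrier_mat)
    have "?U * ?B B C * ?V\<^sup>H * Z = ?U * ?B B C * (?V\<^sup>H * (?V * ?X))"
      unfolding VX by (rule assoc_mult_mat[OF mult_carrier_mat[OF Uc Bc] VHc Z])
    also have "?V\<^sup>H * (?V * ?X) = ?X"
      unfolding assoc_mult_mat[OF VHc Vc Xbc, symmetric] VV by (rule left_mult_one_mat[OF Xbc])
    also have "?U * ?B B C * ?X = ?U * (?B B C * ?X)"
      by (rule assoc_mult_mat[OF Uc Bc Xbc])
    also have BX: "?B B C * ?X =
        four_block_mat (B * X1) (0\<^sub>m r1 (m - l)) (0\<^sub>m (n - r1) l) (C * X2)"
      using B C X1 X2
      by (subst mult_four_block_mat[of _ r1 r2 _ "n - r2" _ "n - r1" _ _ l _ "m - l"]) auto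
    finally have L: "?U * ?B B C * ?V\<^sup>H * Z =
        ?U * four_block_mat (B * X1) (0\<^sub>m r1 (m - l)) (0\<^sub>m (n - r1) l) (C * X2)" .
    have R: "four_block_mat (Y1 * \<Phi>) (0\<^sub>m r1 (m - l)) (0\<^sub>m (n - r1) l) (Y2 * \<Psi>) \<in> carrier_mat n m"
      using four_block_carrier_mat[OF Y1c Y2c] r1 l by simp
    show ?thesis
      unfolding L Z\<Lambda> unitary_qmat_cancel_left[OF U BXc[unfolded BX] R]
      using B C X1 X2 Y1c Y2c
      by (subst four_block_mat_eq_iff[of _ r1 l _ "m - l" _ "n - r1"]) auto
  qed

  note anti = antireflexive_four_block_iff[OF U V P_decomp Q_decomp]
  have phi: "phi2 n P Q Z \<Lambda> = {?U * ?B B C * ?V\<^sup>H | B C. B \<in> ?S1 \<and> C \<in> ?S2}" (is "_ = ?R")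
  proof (intro equalityI subsetI)
    fix A assume A: "A \<in> phi2 n P Q Z \<Lambda>"
    then have "A \<in> carrier_mat n n"
      by (auto simp: phi2_def antireflexive_mats_def)
    then obtain M where M: "M \<in> carrier_mat n n" and AM: "A = ?U * M * ?V\<^sup>H"
      by (rule unitary_qmat_coordinates[OF U V])
    \<comment> \<open>Rows are cut as the columns of \<open>U\<close> are, columns as those of
      \<open>V\<close> are.\<close>
    obtain B1 B C B2 where "split_block M r1 r2 = (B1, B, C, B2)"
      by (metis prod_cases4)
    from split_block[OF this, of "n - r1" "n - r2"]
    have c: "B1 \<in> carrier_mat r1 r2" "B \<in> carrier_mat r1 (n - r2)"
        "C \<in> carrier_mat (n - r1) r2" "B2 \<in> carrier_mat (n - r1) (n - r2)"
      and MB: "M = four_block_mat B1 B C B2"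
      using M r1 r2 by auto
    \<comment> \<open>The open premises are \<open>n = r1 + (n - r1)\<close> and
      \<open>n = r2 + (n - r2)\<close>; with truncated subtraction they rest on \<open>r1\<close>
      and \<open>r2\<close> being at most \<open>n\<close>.\<close>
    have "B1 = 0\<^sub>m r1 r2 \<and> B2 = 0\<^sub>m (n - r1) (n - r2)"
      using A anti[OF _ _ c] r1 r2 by (simp add: phi2_def AM MB)
    then have AB: "A = ?U * ?B B C * ?V\<^sup>H"
      using AM MB by simp
    then have "B * X1 = Y1 * \<Phi> \<and> C * X2 = Y2 * \<Psi>"
      using A eigen[OF c(2,3)] by (simp add: phi2_def)
    then show "A \<in> ?R"
      using AB c by blast
  next
    fix A assume "A \<in> ?R"
    then obtain B C where "B \<in> ?S1" "C \<in> ?S2" and A: "A = ?U * ?B B C * ?V\<^sup>H"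
      by blast
    then have c: "B \<in> carrier_mat r1 (n - r2)" "C \<in> carrier_mat (n - r1) r2"
      and e: "B * X1 = Y1 * \<Phi>" "C * X2 = Y2 * \<Psi>"
      by auto
    have "A \<in> antireflexive_mats n P Q"
      unfolding A using r1 r2 by (subst anti[OF _ _ _ c]) auto
    moreover have "A * Z = Z * \<Lambda>"
      unfolding A using eigen[OF c] e by simp
    ultimately show "A \<in> phi2 n P Q Z \<Lambda>"
      by (simp add: phi2_def)
  qed

  have sol1: "?S1 = {Y1 * \<Phi> * X1p + W * R_proj X1 X1p | W. W \<in> carrier_mat r1 (n - r2)}"
    if "Y1 * \<Phi> * X1p * X1 = Y1 * \<Phi>"
    using inner_inverse_solutions[OF X1 X1p'(1) Y1c X1p'(2) that] X1 by (simp add: R_proj_def)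
  have sol2: "?S2 = {Y2 * \<Psi> * X2p + W * R_proj X2 X2p | W. W \<in> carrier_mat (n - r1) r2}"
    if "Y2 * \<Psi> * X2p * X2 = Y2 * \<Psi>"
    using inner_inverse_solutions[OF X2 X2p'(1) Y2c X2p'(2) that] X2 by (simp add: R_proj_def)
  \<comment> \<open>Any member of the set supplies solutions of both block equations, which makes
    both consistent.\<close>
  have nec: "Y1 * \<Phi> * X1p * X1 = Y1 * \<Phi> \<and> Y2 * \<Psi> * X2p * X2 = Y2 * \<Psi>"
    if ne: "phi2 n P Q Z \<Lambda> \<noteq> {}"
  proof -
    obtain B C where c: "B \<in> carrier_mat r1 (n - r2)" "C \<in> carrier_mat (n - r1) r2"
      and e: "B * X1 = Y1 * \<Phi>" "C * X2 = Y2 * \<Psi>"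
      using ne unfolding phi by auto
    show ?thesis
      using inner_inverse_consistent[OF X1 X1p'(1) c(1) X1p'(2)]
        inner_inverse_consistent[OF X2 X2p'(1) c(2) X2p'(2)] by (simp only: e)
  qed
  have gen: "phi2 n P Q Z \<Lambda> = {?U * ?B (Y1 * \<Phi> * X1p + W1 * R_proj X1 X1p)
        (Y2 * \<Psi> * X2p + W2 * R_proj X2 X2p) * (V1\<^sup>H @\<^sub>r V2\<^sup>H)
      | W1 W2. W1 \<in> carrier_mat r1 (n - r2) \<and> W2 \<in> carrier_mat (n - r1) r2}"
    if "Y1 * \<Phi> * X1p * X1 = Y1 * \<Phi> \<and> Y2 * \<Psi> * X2p * X2 = Y2 * \<Psi>"
    unfolding phi sol1[OF that[THEN conjunct1]] sol2[OF that[THEN conjunct2]]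
      conj_transpose_append_cols[OF V1 V2] by blast
  have suff: "phi2 n P Q Z \<Lambda> \<noteq> {}"
    if "Y1 * \<Phi> * X1p * X1 = Y1 * \<Phi> \<and> Y2 * \<Psi> * X2p * X2 = Y2 * \<Psi>"
    \<comment> \<open>Zero matrices serve as the parameters \<open>W1\<close> and \<open>W2\<close>
      of a member.\<close>
    unfolding gen[OF that] using zero_carrier_mat by blast
  show ?thesis
    using nec suff gen by blast
qed

end
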